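(* Let $\mathbb{E}^1=\bigcup_{n\ge 1}C_n\subseteq\mathbb{R}^2$ be the earring space, where $C_n$ is the circle of radius $1/n$ centered at $(1/n,0)$, with the subspace topology, and let $b_0=(0,0)$. Then the space $\pi_1^{wh}(\mathbb{E}^1,b_0)$ is not separable (that is, it has no countable dense subset).
   Context: For a based space $(X,x_0)$, $\pi_1^{wh}(X,x_0)$ denotes the fundamental group $\pi_1(X,x_0)$ with the whisker topology: the topology having as a basis the sets $B([\zeta],U)=\{[\zeta\cdot\eta] : \eta \text{ a loop based at } x_0 \text{ with image contained in } U\}$, where $[\zeta]\in\pi_1(X,x_0)$ and $U$ is an open neighborhood of $x_0$ in $X$. Here $\zeta\cdot\eta$ is path concatenation. *)

theory Defs
  imports "HOL-Analysis.Analysis"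
begin

definition loops_at :: "'a::topological_space set \<Rightarrow> 'a \<Rightarrow> (real \<Rightarrow> 'a) set" where
  "loops_at X x0 = {p. path p \<and> path_image p \<subseteq> X \<and> pathstart p = x0 \<and> pathfinish p = x0}"

text \<open>The class of a path under homotopy in \<open>X\<close> relative to endpoints. \<open>homotopic_paths\<close> only
  sees a function on \<open>{0..1}\<close>, so the values outside that interval do not matter.\<close>

definition path_class :: "'a::topological_space set \<Rightarrow> (real \<Rightarrow> 'a) \<Rightarrow> (real \<Rightarrow> 'a) set" where
  "path_class X p = {q. homotopic_paths X p q}"

text \<open>The underlying set of the fundamental group; its multiplication is induced by \<open>+++\<close>.\<close>

definition fundamental_group :: "'a::topological_space set \<Rightarrow> 'a \<Rightarrow> (real \<Rightarrow> 'a) set set" where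
  "fundamental_group X x0 = path_class X ` loops_at X x0"

text \<open>The basic set \<open>B([\<zeta>], U)\<close>; by \<open>whisker_nbhd_cong\<close> it depends only on the class of \<open>\<zeta>\<close>.\<close>

definition whisker_nbhd ::
    "'a::topological_space set \<Rightarrow> 'a \<Rightarrow> (real \<Rightarrow> 'a) \<Rightarrow> 'a set \<Rightarrow> (real \<Rightarrow> 'a) set set" where
  "whisker_nbhd X x0 \<zeta> U = {path_class X (\<zeta> +++ \<eta>) | \<eta>. \<eta> \<in> loops_at U x0}"

definition whisker_basic ::
    "'a::topological_space set \<Rightarrow> 'a \<Rightarrow> (real \<Rightarrow> 'a) set set \<Rightarrow> bool" where
  "whisker_basic X x0 W \<longleftrightarrow>
    (\<exists>\<zeta> U. \<zeta> \<in> loops_at X x0 \<and> openin (top_of_set X) U \<and> x0 \<in> U \<and> W = whisker_nbhd X x0 \<zeta> U)"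

text \<open>\<open>openin_whisker_topology\<close> shows that the basic sets do form a basis, and
  \<open>topspace_whisker_topology\<close> that the underlying set is the fundamental group.\<close>

definition whisker_topology ::
    "'a::topological_space set \<Rightarrow> 'a \<Rightarrow> (real \<Rightarrow> 'a) set topology" where
  "whisker_topology X x0 = topology (arbitrary union_of whisker_basic X x0)"

definition earring :: "(real \<times> real) set" where
  "earring = (\<Union>n\<in>{1::nat..}. sphere (1 / real n, 0) (1 / real n))"

lemma path_class_eq_iff:
  assumes "p \<in> loops_at X x0"
  shows "path_class X p = path_class X q \<longleftrightarrow> homotopic_paths X p q"
proof -
  have "homotopic_paths X p p"
    using assms by (simp add: loops_at_def)
  then show ?thesis
    unfolding path_class_def
    by (auto simp: set_eq_iff intro: homotopic_paths_sym homotopic_paths_trans)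
qed

lemma loops_at_mono: "U \<subseteq> X \<Longrightarrow> loops_at U x0 \<subseteq> loops_at X x0"
  by (auto simp: loops_at_def)

lemma loops_at_join:
  "p \<in> loops_at X x0 \<Longrightarrow> q \<in> loops_at X x0 \<Longrightarrow> p +++ q \<in> loops_at X x0"
  by (auto simp: loops_at_def path_image_join)

lemma whisker_nbhd_absorb:
  assumes \<zeta>: "\<zeta> \<in> loops_at X x0" and U: "U \<subseteq> X" and VU: "V \<subseteq> U" and \<eta>: "\<eta> \<in> loops_at U x0"
    and \<omega>: "\<omega> \<in> loops_at X x0" and eq: "path_class X \<omega> = path_class X (\<zeta> +++ \<eta>)"
  shows "whisker_nbhd X x0 \<omega> V \<subseteq> whisker_nbhd X x0 \<zeta> U"
proof
  fix c assume "c \<in> whisker_nbhd X x0 \<omega> V"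
  then obtain \<delta> where \<delta>: "\<delta> \<in> loops_at V x0" and c: "c = path_class X (\<omega> +++ \<delta>)"
    by (auto simp: whisker_nbhd_def)
  have \<delta>U: "\<delta> \<in> loops_at U x0" and \<delta>X: "\<delta> \<in> loops_at X x0" and \<eta>X: "\<eta> \<in> loops_at X x0"
    using \<delta> \<eta> U VU loops_at_mono by blast+
  have "homotopic_paths X \<omega> (\<zeta> +++ \<eta>)"
    using eq path_class_eq_iff[OF \<omega>] by blast
  then have "homotopic_paths X (\<omega> +++ \<delta>) ((\<zeta> +++ \<eta>) +++ \<delta>)"
    using \<delta>X \<omega> by (intro homotopic_paths_join) (auto simp: loops_at_def)
  moreover have "homotopic_paths X (\<zeta> +++ (\<eta> +++ \<delta>)) ((\<zeta> +++ \<eta>) +++ \<delta>)"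
    using \<zeta> \<eta>X \<delta>X by (intro homotopic_paths_assoc) (auto simp: loops_at_def)
  ultimately have "homotopic_paths X (\<omega> +++ \<delta>) (\<zeta> +++ (\<eta> +++ \<delta>))"
    by (blast intro: homotopic_paths_sym homotopic_paths_trans)
  then have "c = path_class X (\<zeta> +++ (\<eta> +++ \<delta>))"
    using c path_class_eq_iff[OF loops_at_join[OF \<omega> \<delta>X]] by blast
  then show "c \<in> whisker_nbhd X x0 \<zeta> U"
    using loops_at_join[OF \<eta> \<delta>U] by (auto simp: whisker_nbhd_def)
qed

lemma homotopic_paths_join_const:
  assumes p: "p \<in> loops_at X x0"
  shows "homotopic_paths X (p +++ (\<lambda>t. x0)) p"
proof -
  have \<section>: "continuous_on {0..1} (\<lambda>t::real. if t \<le> 1/2 then 2 *\<^sub>R t else 1)"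
    unfolding split_01
    by (rule continuous_on_cases continuous_intros | force simp: pathfinish_def joinpaths_def)+
  show ?thesis
    apply (rule homotopic_paths_sym)
    using p unfolding loops_at_def pathfinish_def joinpaths_def
    by (intro \<section> continuous_on_cases continuous_intros homotopic_paths_reparametrize
        [where f = "\<lambda>t. if t \<le> 1/2 then 2 *\<^sub>R t else 1"]; force)
qed

lemma const_loop: "x0 \<in> U \<Longrightarrow> (\<lambda>t. x0) \<in> loops_at U x0"
  by (auto simp: loops_at_def path_def pathstart_def pathfinish_def path_image_def)

lemma path_class_join_const:
  assumes "p \<in> loops_at X x0"
  shows "path_class X (p +++ (\<lambda>t. x0)) = path_class X p"
  using homotopic_paths_join_const[OF assms] path_class_eq_iff[OF assms] homotopic_paths_sym
  by metis

lemma whisker_nbhd_self: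
  assumes "\<omega> \<in> loops_at X x0" and "x0 \<in> U"
  shows "path_class X \<omega> \<in> whisker_nbhd X x0 \<omega> U"
  using path_class_join_const[OF assms(1)] const_loop[OF assms(2)]
  unfolding whisker_nbhd_def by blast

lemma whisker_nbhd_cong:
  assumes z: "\<zeta> \<in> loops_at X x0" and z': "\<zeta>' \<in> loops_at X x0"
    and U: "U \<subseteq> X" "x0 \<in> U" and eq: "path_class X \<zeta> = path_class X \<zeta>'"
  shows "whisker_nbhd X x0 \<zeta> U = whisker_nbhd X x0 \<zeta>' U"
  using whisker_nbhd_absorb[OF z U(1) subset_refl const_loop[OF U(2)] z']
    whisker_nbhd_absorb[OF z' U(1) subset_refl const_loop[OF U(2)] z]
    path_class_join_const[OF z] path_class_join_const[OF z'] eq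
  by auto

lemma whisker_nbhd_subset:
  assumes "\<zeta> \<in> loops_at X x0" "U \<subseteq> X"
  shows "whisker_nbhd X x0 \<zeta> U \<subseteq> fundamental_group X x0"
  using assms loops_at_join[of \<zeta> X x0] loops_at_mono[of U X x0]
  unfolding whisker_nbhd_def fundamental_group_def by blast

lemma istopology_whisker: "istopology (arbitrary union_of whisker_basic X x0)"
  unfolding istopology_base_eq
proof (intro allI impI, elim conjE)
  fix S T assume "whisker_basic X x0 S" "whisker_basic X x0 T"
  then obtain \<zeta> U \<xi> V where \<zeta>: "\<zeta> \<in> loops_at X x0" and U: "openin (top_of_set X) U" "x0 \<in> U"
    and S: "S = whisker_nbhd X x0 \<zeta> U" and \<xi>: "\<xi> \<in> loops_at X x0"
    and V: "openin (top_of_set X) V" "x0 \<in> V" and T: "T = whisker_nbhd X x0 \<xi> V"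
    unfolding whisker_basic_def by blast
  have UX: "U \<subseteq> X" and VX: "V \<subseteq> X"
    using U(1) V(1) by (auto dest: openin_imp_subset)
  have "\<exists>W. whisker_basic X x0 W \<and> c \<in> W \<and> W \<subseteq> S \<inter> T" if c: "c \<in> S \<inter> T" for c
  proof -
    obtain \<eta> where \<eta>: "\<eta> \<in> loops_at U x0" "c = path_class X (\<zeta> +++ \<eta>)"
      using c S unfolding whisker_nbhd_def by blast
    obtain \<delta> where \<delta>: "\<delta> \<in> loops_at V x0" "c = path_class X (\<xi> +++ \<delta>)"
      using c T unfolding whisker_nbhd_def by blast
    define \<omega> where "\<omega> = \<zeta> +++ \<eta>"
    have \<omega>: "\<omega> \<in> loops_at X x0"
      using \<zeta> \<eta>(1) UX loops_at_mono loops_at_join unfolding \<omega>_def by blast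
    let ?W = "whisker_nbhd X x0 \<omega> (U \<inter> V)"
    have "?W \<subseteq> S"
      unfolding S by (rule whisker_nbhd_absorb[OF \<zeta> UX _ \<eta>(1) \<omega>]) (auto simp: \<omega>_def)
    moreover have "?W \<subseteq> T"
      unfolding T by (rule whisker_nbhd_absorb[OF \<xi> VX _ \<delta>(1) \<omega>]) (use \<eta>(2) \<delta>(2) \<omega>_def in auto)
    moreover have "c \<in> ?W"
      using whisker_nbhd_self[OF \<omega>, of "U \<inter> V"] U(2) V(2) \<eta>(2) \<omega>_def by auto
    moreover have "whisker_basic X x0 ?W"
      unfolding whisker_basic_def using \<omega> U V by blast
    ultimately show ?thesis by blast
  qed
  then show "(arbitrary union_of whisker_basic X x0) (S \<inter> T)"
    unfolding arbitrary_union_of_alt by blast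
qed

lemma openin_whisker_topology:
  "openin (whisker_topology X x0) = arbitrary union_of whisker_basic X x0"
  unfolding whisker_topology_def using istopology_whisker by (rule topology_inverse')

lemma topspace_whisker_topology: "topspace (whisker_topology X x0) = fundamental_group X x0"
proof
  show "topspace (whisker_topology X x0) \<subseteq> fundamental_group X x0"
  proof
    fix c assume "c \<in> topspace (whisker_topology X x0)"
    then obtain W where "c \<in> W" "whisker_basic X x0 W"
      using openin_topspace[of "whisker_topology X x0"]
      unfolding openin_whisker_topology arbitrary_union_of_alt by blast
    then show "c \<in> fundamental_group X x0"
      unfolding whisker_basic_def using whisker_nbhd_subset openin_imp_subset by blast
  qed
next
  show "fundamental_group X x0 \<subseteq> topspace (whisker_topology X x0)"
  proof
    fix c assume "c \<in> fundamental_group X x0"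
    then obtain \<omega> where \<omega>: "\<omega> \<in> loops_at X x0" and c: "c = path_class X \<omega>"
      unfolding fundamental_group_def by blast
    have x0: "x0 \<in> X"
      using \<omega> pathstart_in_path_image[of \<omega>] by (auto simp: loops_at_def)
    have "whisker_basic X x0 (whisker_nbhd X x0 \<omega> X)"
      unfolding whisker_basic_def using \<omega> x0 openin_subtopology_self by blast
    then have "openin (whisker_topology X x0) (whisker_nbhd X x0 \<omega> X)"
      unfolding openin_whisker_topology arbitrary_union_of_alt by blast
    then show "c \<in> topspace (whisker_topology X x0)"
      using openin_subset whisker_nbhd_self[OF \<omega> x0] c by blast
  qed
qed

end

theory Submission
  imports Defs
begin

text \<open>
  Let \<open>U\<close> be the earring without the point of \<open>C\<^sub>1\<close> opposite to the base point. The sets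
  \<open>B([\<zeta>], U)\<close> are the left cosets of an open subgroup, so a countable dense set can exist only if
  there are countably many of them. The proof exhibits uncountably many. For a set
  \<open>S\<close> of indices at least \<open>2\<close>, let \<open>w\<^sub>S\<close> be the infinite concatenation of one turn around each
  circle \<open>C\<^sub>k\<close> with \<open>k \<in> S\<close>, and let \<open>a\<close> be one turn around \<open>C\<^sub>1\<close>. The cosets of \<open>w\<^sub>S \<cdot> a\<close> for
  different \<open>S\<close> turn out to be disjoint: \<open>a\<close> protects \<open>w\<^sub>S\<close> from cancellation against the
  factor in \<open>U\<close> on the right.

  To detect this, pass to the infinite cyclic covering of the earring that unrolls \<open>C\<^sub>1\<close> to a line
  and leaves one copy of the other circles at each integer of this line. The lift of
  \<open>w\<^sub>S \<cdot> a \<cdot> \<eta>\<close> runs through \<open>w\<^sub>S\<close> in the copy at \<open>0\<close>, then moves on to \<open>1\<close>; the lift of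
  the loop \<open>\<eta>\<close> in \<open>U\<close> never comes back to the copy at \<open>0\<close>, because it does not get past the
  removed point. Collapse the covering onto the circle \<open>C\<^sub>n\<close> in the copy at \<open>0\<close>. The number of
  turns of the resulting loop depends only on the homotopy class of \<open>w\<^sub>S \<cdot> a \<cdot> \<eta>\<close>, and it tells
  whether \<open>n \<in> S\<close>.

  The covering is the set of pairs \<open>(x, w)\<close> with \<open>exp w = q x\<close>, where \<open>q\<close> collapses the
  earring onto \<open>C\<^sub>1\<close> and \<open>C\<^sub>1\<close> is identified with the unit circle. Lifts of paths and of homotopies
  are therefore continuous logarithms, which exist on the unit square (\<open>log_lift_square\<close>)
  and are unique on an interval (\<open>log_lift_unique\<close>). The invariance of the number of turns is
  \<open>sheet_winding_homotopic\<close>, and its value is computed in \<open>sheet_winding_word\<close>.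
\<close>

section \<open>Continuous logarithms along paths and homotopies\<close>

definition log_lift :: "(real \<Rightarrow> complex) \<Rightarrow> (real \<Rightarrow> complex) \<Rightarrow> bool" where
  "log_lift f L \<longleftrightarrow> continuous_on {0..1} L \<and> L 0 = 0 \<and> (\<forall>t\<in>{0..1}. exp (L t) = f t)"

text \<open>The kernel of the exponential function is discrete.\<close>

lemma continuous_exp_one_const:
  fixes f :: "real \<Rightarrow> complex"
  assumes "continuous_on {0..1} f" and "\<And>t. t \<in> {0..1} \<Longrightarrow> exp (f t) = 1" and t: "t \<in> {0..1}"
  shows "f t = f 0"
proof -
  have "2 * pi \<le> norm (f y - f x)" if "x \<in> {0..1}" "y \<in> {0..1}" "f y \<noteq> f x" for x y
  proof -
    have "exp (f x) = exp (f y)"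
      using assms(2) that by simp
    then have "\<not> \<bar>Im (f y) - Im (f x)\<bar> < 2 * pi"
      using exp_complex_eqI[of "f y" "f x"] that by auto
    then show ?thesis
      using abs_Im_le_cmod[of "f y - f x"] by simp
  qed
  then have "f constant_on {0..1}"
    using assms(1)
    by (intro continuous_discrete_range_constant) (auto intro!: exI[of _ "2*pi"])
  then show ?thesis
    using t unfolding constant_on_def by force
qed

lemma log_lift_unique:
  assumes f: "log_lift f L" and g: "log_lift g M"
    and eq: "\<And>t. t \<in> {0..1} \<Longrightarrow> f t = g t" and t: "t \<in> {0..1}"
  shows "L t = M t"
proof -
  have "(\<lambda>t. L t - M t) t = (\<lambda>t. L t - M t) 0"
  proof (rule continuous_exp_one_const[OF _ _ t])
    show "continuous_on {0..1} (\<lambda>t. L t - M t)"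
      using f g unfolding log_lift_def by (intro continuous_intros) auto
    show "exp (L t - M t) = 1" if "t \<in> {0..1}" for t
    proof -
      have "exp (L t) = exp (M t)"
        using f g eq[OF that] that unfolding log_lift_def by auto
      then show ?thesis
        by (simp add: exp_diff)
    qed
  qed
  then show ?thesis
    using f g unfolding log_lift_def by simp
qed

lemma log_lift_join:
  assumes L: "log_lift f L" and M: "log_lift g M" and f1: "f 1 = 1"
  shows "log_lift (f +++ g) (L +++ (\<lambda>t. L 1 + M t))"
proof -
  have "path (L +++ (\<lambda>t. L 1 + M t))"
    using L M unfolding log_lift_def
    by (intro path_join_imp) (auto simp: path_def pathfinish_def pathstart_def intro!: continuous_intros)
  moreover have "exp ((L +++ (\<lambda>t. L 1 + M t)) t) = (f +++ g) t" if "t \<in> {0..1}" for t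
    using L M f1 that unfolding log_lift_def by (auto simp: joinpaths_def exp_add)
  ultimately show ?thesis
    using L unfolding log_lift_def path_def by (auto simp: joinpaths_def)
qed

text \<open>On the edges where \<open>K\<close> is constant, the logarithm moves in a translate of the discrete
  kernel of the exponential function, so it is constant too. In particular all its rows
  start at \<open>0\<close> and have a common endpoint.\<close>

lemma log_lift_square:
  fixes K :: "real \<times> real \<Rightarrow> complex"
  assumes K: "continuous_on ({0..1} \<times> {0..1}) K"
    and nz: "\<And>z. z \<in> {0..1} \<times> {0..1} \<Longrightarrow> K z \<noteq> 0"
    and edge: "\<And>s. s \<in> {0..1} \<Longrightarrow> K (s, 0) = 1 \<and> K (s, 1) = 1"
  obtains L where "continuous_on ({0..1} \<times> {0..1}) L"
    and "\<And>z. z \<in> {0..1} \<times> {0..1} \<Longrightarrow> exp (L z) = K z"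
    and "\<And>s. s \<in> {0..1} \<Longrightarrow> log_lift (\<lambda>t. K (s, t)) (\<lambda>t. L (s, t))"
    and "\<And>s. s \<in> {0..1} \<Longrightarrow> L (s, 1) = L (0, 1)"
proof -
  have "contractible ({0..1::real} \<times> {0..1::real})"
    by (intro convex_imp_contractible convex_Times convex_closed_interval)
  then obtain G where G: "continuous_on ({0..1} \<times> {0..1}) G"
    and KG: "\<And>z. z \<in> {0..1} \<times> {0..1} \<Longrightarrow> K z = exp (G z)"
    using continuous_logarithm_on_contractible[OF K _ nz] by blast
  define L where "L = (\<lambda>z. G z - G (0, 0))"
  have G0: "exp (G (0, 0)) = 1"
    using KG[of "(0, 0)"] edge[of 0] by simp
  have L: "continuous_on ({0..1} \<times> {0..1}) L"
    unfolding L_def by (intro continuous_intros G)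
  have KL: "exp (L z) = K z" if "z \<in> {0..1} \<times> {0..1}" for z
    using KG[OF that] G0 by (simp add: L_def exp_diff)
  have row: "continuous_on {0..1} (\<lambda>t. L (s, t))" if "s \<in> {0..1}" for s
    by (rule continuous_on_compose2[OF L]) (use that in \<open>auto intro!: continuous_intros\<close>)
  have col: "continuous_on {0..1} (\<lambda>s. L (s, t))" if "t \<in> {0..1}" for t
    by (rule continuous_on_compose2[OF L]) (use that in \<open>auto intro!: continuous_intros\<close>)
  have start: "L (s, 0) = 0" if "s \<in> {0..1}" for s
    using continuous_exp_one_const[OF col[of 0] _ that] KL edge by (auto simp: L_def)
  have fin: "L (s, 1) = L (0, 1)" if "s \<in> {0..1}" for s
    using continuous_exp_one_const[OF col[of 1] _ that] KL edge by auto
  show ?thesis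
  proof (rule that[OF L KL])
    show "log_lift (\<lambda>t. K (s, t)) (\<lambda>t. L (s, t))" if "s \<in> {0..1}" for s
      unfolding log_lift_def using that by (intro conjI row start ballI KL SigmaI)
  qed (use fin in blast)+
qed

section \<open>The circles of the earring\<close>

text \<open>One turn around \<open>C\<^sub>1\<close> for each unit of time; scaling by \<open>1 / k\<close> gives \<open>C\<^sub>k\<close>.\<close>

definition circle_turn :: "real \<Rightarrow> real \<times> real" where
  "circle_turn v = (1 - cos (2 * pi * v), - sin (2 * pi * v))"

text \<open>The collapse of the earring onto \<open>C\<^sub>n\<close>, read as a map to the unit circle of \<open>\<complex>\<close> that sends the
  base point to \<open>1\<close>. The condition is the equation of \<open>C\<^sub>n\<close>.\<close>

definition circle_coord :: "nat \<Rightarrow> real \<times> real \<Rightarrow> complex" where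
  "circle_coord n z = (if real n * ((fst z)\<^sup>2 + (snd z)\<^sup>2) = 2 * fst z
     then Complex (1 - n * fst z) (- (n * snd z)) else 1)"

lemma mem_circle_iff:
  assumes "n \<ge> 1"
  shows "z \<in> sphere (1 / real n, 0) (1 / real n) \<longleftrightarrow>
    real n * ((fst z)\<^sup>2 + (snd z)\<^sup>2) = 2 * fst z"
proof -
  obtain x y where z: "z = (x, y)"
    by fastforce
  have n: "real n > 0"
    using assms by simp
  have "z \<in> sphere (1 / real n, 0) (1 / real n) \<longleftrightarrow> (1 / real n - x)\<^sup>2 + y\<^sup>2 = (1 / real n)\<^sup>2"
  proof -
    have d: "dist (1 / real n, 0) z = sqrt ((1 / real n - x)\<^sup>2 + y\<^sup>2)"
      by (simp add: z dist_Pair_Pair dist_real_def)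
    have r: "sqrt ((1 / real n)\<^sup>2) = 1 / real n"
      using n by (subst real_sqrt_abs) simp
    show ?thesis
      using real_sqrt_eq_iff[of "(1 / real n - x)\<^sup>2 + y\<^sup>2" "(1 / real n)\<^sup>2"]
      unfolding r by (simp only: mem_sphere d)
  qed
  also have "\<dots> \<longleftrightarrow> real n * (x\<^sup>2 + y\<^sup>2) = 2 * x"
  proof -
    have "(1 / real n - x)\<^sup>2 + y\<^sup>2 - (1 / real n)\<^sup>2 = (real n * (x\<^sup>2 + y\<^sup>2) - 2 * x) / real n"
      using n by (simp add: field_simps power2_eq_square)
    then show ?thesis
      using n by (metis divide_eq_0_iff eq_iff_diff_eq_0 less_irrefl)
  qed
  finally show ?thesis
    by (simp add: z)
qed

lemma earring_iff:
  "z \<in> earring \<longleftrightarrow> (\<exists>n\<ge>1. real n * ((fst z)\<^sup>2 + (snd z)\<^sup>2) = 2 * fst z)"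
  using mem_circle_iff[of _ z] by (auto simp: earring_def)

lemma two_circles:
  fixes z :: "real \<times> real"
  assumes "real n * ((fst z)\<^sup>2 + (snd z)\<^sup>2) = 2 * fst z"
    and "real k * ((fst z)\<^sup>2 + (snd z)\<^sup>2) = 2 * fst z" and "n \<noteq> k"
  shows "z = (0, 0)"
proof -
  have "(real n - real k) * ((fst z)\<^sup>2 + (snd z)\<^sup>2) = 0"
    using assms by (simp add: algebra_simps)
  then show ?thesis
    using assms(3) by (auto simp: sum_power2_eq_zero_iff prod_eq_iff)
qed

lemma circle_turn_eqn:
  "(fst (circle_turn v))\<^sup>2 + (snd (circle_turn v))\<^sup>2 = 2 * fst (circle_turn v)"
  using sin_cos_squared_add[of "2 * pi * v"]
  by (simp add: circle_turn_def power2_eq_square algebra_simps)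

lemma circle_point_eqn:
  assumes "k \<ge> 1" and z: "z = (1 / real k) *\<^sub>R circle_turn v"
  shows "real k * ((fst z)\<^sup>2 + (snd z)\<^sup>2) = 2 * fst z"
proof -
  have "real k * ((fst z)\<^sup>2 + (snd z)\<^sup>2)
      = ((fst (circle_turn v))\<^sup>2 + (snd (circle_turn v))\<^sup>2) / real k"
    using assms by (simp add: field_simps power2_eq_square)
  then show ?thesis
    using assms by (simp add: circle_turn_eqn)
qed

lemma circle_point_in_earring:
  "k \<ge> 1 \<Longrightarrow> (1 / real k) *\<^sub>R circle_turn v \<in> earring"
  unfolding earring_iff using circle_point_eqn by blast

lemma base_in_earring: "(0, 0) \<in> earring"
  unfolding earring_iff by (auto intro: exI[of _ 1])

lemma circle_coord_base [simp]: "circle_coord n (0, 0) = 1"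
  by (simp add: circle_coord_def complex_eq_iff)

lemma circle_coord_circle_point:
  assumes "k \<ge> 1"
  shows "circle_coord n ((1 / real k) *\<^sub>R circle_turn v)
    = (if n = k then exp (2 * pi * \<i> * v) else 1)"
proof -
  let ?z = "(1 / real k) *\<^sub>R circle_turn v"
  have k: "real k * ((fst ?z)\<^sup>2 + (snd ?z)\<^sup>2) = 2 * fst ?z"
    by (rule circle_point_eqn[OF assms refl])
  show ?thesis
  proof (cases "n = k")
    case True
    then have "circle_coord n ?z = Complex (cos (2 * pi * v)) (sin (2 * pi * v))"
      unfolding circle_coord_def True if_P[OF k] using assms by (simp add: circle_turn_def)
    also have "\<dots> = cis (2 * pi * v)"
      by (simp add: cis.ctr)
    finally show ?thesis
      using True by (simp add: cis_conv_exp mult_ac)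
  next
    case False
    show ?thesis
    proof (cases "real n * ((fst ?z)\<^sup>2 + (snd ?z)\<^sup>2) = 2 * fst ?z")
      case True
      then have "?z = (0, 0)"
        using two_circles[OF _ k False] by blast
      then show ?thesis
        using False by (metis circle_coord_base)
    qed (use False in \<open>simp add: circle_coord_def\<close>)
  qed
qed

lemma norm_circle_coord: "norm (circle_coord n z) = 1"
proof (cases "real n * ((fst z)\<^sup>2 + (snd z)\<^sup>2) = 2 * fst z")
  case True
  have "(1 - n * fst z)\<^sup>2 + (n * snd z)\<^sup>2
      = 1 + n * (n * ((fst z)\<^sup>2 + (snd z)\<^sup>2) - 2 * fst z)"
    by (simp add: power2_eq_square algebra_simps)
  also have "\<dots> = 1"
    unfolding True by simp
  finally show ?thesis
    unfolding circle_coord_def if_P[OF True] by (simp add: cmod_def)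
qed (simp add: circle_coord_def)

text \<open>The points of the earring outside \<open>C\<^sub>n\<close> lie inside \<open>C\<^sub>n\<^sub>+\<^sub>1\<close> or outside \<open>C\<^sub>n\<^sub>-\<^sub>1\<close> (boundaries
  included), so together with the base point they form a relatively closed set. On it the collapse is
  constant.\<close>

lemma continuous_on_circle_coord: "continuous_on earring (circle_coord n)"
proof -
  define A where "A = earring \<inter> {z. real n * ((fst z)\<^sup>2 + (snd z)\<^sup>2) = 2 * fst z}"
  define B where "B = earring \<inter> ({z. real (Suc n) * ((fst z)\<^sup>2 + (snd z)\<^sup>2) \<le> 2 * fst z} \<union>
    {z. 2 * fst z \<le> (real n - 1) * ((fst z)\<^sup>2 + (snd z)\<^sup>2)})"
  have AB: "A \<union> B = earring"
  proof -
    have "z \<in> A \<union> B" if z: "z \<in> earring" for z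
    proof -
      obtain m where m: "m \<ge> 1" "real m * ((fst z)\<^sup>2 + (snd z)\<^sup>2) = 2 * fst z"
        using z earring_iff by blast
      consider "m = n" | "m \<ge> Suc n" | "real m \<le> real n - 1"
        by linarith
      then show ?thesis
      proof cases
        case 1
        then show ?thesis using m z by (auto simp: A_def)
      next
        case 2
        then have "real (Suc n) * ((fst z)\<^sup>2 + (snd z)\<^sup>2) \<le> real m * ((fst z)\<^sup>2 + (snd z)\<^sup>2)"
          by (intro mult_right_mono) auto
        then show ?thesis using m z unfolding B_def by auto
      next
        case 3
        then have "real m * ((fst z)\<^sup>2 + (snd z)\<^sup>2) \<le> (real n - 1) * ((fst z)\<^sup>2 + (snd z)\<^sup>2)"
          by (intro mult_right_mono) auto
        then show ?thesis using m z unfolding B_def by auto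
      qed
    qed
    then show ?thesis by (auto simp: A_def B_def)
  qed
  have base: "z = (0, 0)" if "z \<in> B" "real n * ((fst z)\<^sup>2 + (snd z)\<^sup>2) = 2 * fst z" for z
  proof -
    have "(fst z)\<^sup>2 + (snd z)\<^sup>2 \<le> 0"
      using that unfolding B_def by (auto simp: algebra_simps)
    then show ?thesis
      by (simp add: prod_eq_iff sum_power2_le_zero_iff)
  qed
  have "continuous_on (A \<union> B) (\<lambda>z. if real n * ((fst z)\<^sup>2 + (snd z)\<^sup>2) = 2 * fst z
      then Complex (1 - n * fst z) (- (n * snd z)) else 1)"
  proof (rule continuous_on_cases_local)
    show "closedin (top_of_set (A \<union> B)) A"
      unfolding AB by (subst A_def)
        (intro closedin_closed_Int closed_Collect_eq continuous_intros)
    show "closedin (top_of_set (A \<union> B)) B"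
      unfolding AB by (subst B_def)
        (intro closedin_closed_Int closed_Un closed_Collect_le continuous_intros)
    show "continuous_on A (\<lambda>z. Complex (1 - n * fst z) (- (n * snd z)))"
      unfolding Complex_eq by (intro continuous_intros)
    show "continuous_on B (\<lambda>z. 1 :: complex)"
      by (intro continuous_intros)
  next
    fix z
    assume "z \<in> A \<and> \<not> real n * ((fst z)\<^sup>2 + (snd z)\<^sup>2) = 2 * fst z \<or>
      z \<in> B \<and> real n * ((fst z)\<^sup>2 + (snd z)\<^sup>2) = 2 * fst z"
    then have "z = (0, 0)"
      using base by (auto simp: A_def)
    then show "Complex (1 - n * fst z) (- (n * snd z)) = 1"
      by (simp add: complex_eq_iff)
  qed
  then show ?thesis
    unfolding AB circle_coord_def[abs_def] .
qed

section \<open>The winding number in one sheet of the cyclic covering\<close>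

definition cyclic_cover :: "((real \<times> real) \<times> complex) set" where
  "cyclic_cover = {(z, w). z \<in> earring \<and> exp w = circle_coord 1 z}"

text \<open>On the covering, \<open>w\<close> is purely imaginary and \<open>\<bar>Im w\<bar> \<le> \<pi>\<close> cuts out the copy at \<open>0\<close> of the
  small circles, together with the two halves of \<open>C\<^sub>1\<close> adjacent to it.\<close>

definition sheet_coord :: "nat \<Rightarrow> (real \<times> real) \<times> complex \<Rightarrow> complex" where
  "sheet_coord n = (\<lambda>(z, w). if \<bar>Im w\<bar> \<le> pi then circle_coord n z else 1)"

text \<open>The sheets are separated by points of \<open>C\<^sub>1\<close> other than the base point, where
  the collapse onto another circle is \<open>1\<close> already.\<close>

lemma continuous_on_sheet_coord:
  assumes "n \<noteq> 1"
  shows "continuous_on cyclic_cover (sheet_coord n)"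
proof -
  have eq: "circle_coord n (fst u) = 1" if u: "u \<in> cyclic_cover" "\<bar>Im (snd u)\<bar> = pi" for u
  proof (rule ccontr)
    obtain z w where zw: "u = (z, w)" by fastforce
    assume "circle_coord n (fst u) \<noteq> 1"
    then have nz: "real n * ((fst z)\<^sup>2 + (snd z)\<^sup>2) = 2 * fst z" and z0: "z \<noteq> (0, 0)"
      using circle_coord_base[of n] by (auto simp: zw circle_coord_def simp del: circle_coord_base split: if_splits)
    have "circle_coord 1 z = 1"
      using two_circles[OF nz, of 1] assms z0 by (auto simp: circle_coord_def)
    then have "exp w = 1"
      using u zw by (simp add: cyclic_cover_def)
    moreover have "exp w = - exp (Re w)"
    proof -
      have "Im w = pi \<or> Im w = - pi"
        using u(2) zw by auto
      then show ?thesis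
        by (auto simp: complex_eq_iff Re_exp Im_exp)
    qed
    ultimately show False
      using exp_gt_zero[of "Re w"] by (simp add: complex_eq_iff exp_of_real)
  qed
  have "continuous_on cyclic_cover
      (\<lambda>u. if \<bar>Im (snd u)\<bar> \<le> pi then circle_coord n (fst u) else 1)"
  proof (rule continuous_on_cases_le)
    show "continuous_on {u \<in> cyclic_cover. \<bar>Im (snd u)\<bar> \<le> pi} (\<lambda>u. circle_coord n (fst u))"
      by (rule continuous_on_compose2[OF continuous_on_circle_coord])
        (auto simp: cyclic_cover_def intro!: continuous_intros)
  qed (use eq in \<open>auto intro!: continuous_intros\<close>)
  then show ?thesis
    by (simp add: sheet_coord_def case_prod_unfold)
qed

lemma sheet_coord_nonzero: "sheet_coord n u \<noteq> 0"
  using norm_circle_coord[of n "fst u"] by (auto simp: sheet_coord_def split: prod.splits)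

lemma sheet_coord_base [simp]: "sheet_coord n ((0, 0), w) = 1"
  by (simp add: sheet_coord_def)

text \<open>\<open>\<theta>\<close> is the height of the lift of \<open>p\<close> to the covering, and the value \<open>c\<close> is
  \<open>2 * pi * \<i>\<close> times the number of turns around \<open>C\<^sub>n\<close> in the copy at \<open>0\<close>.\<close>

definition sheet_winding :: "nat \<Rightarrow> (real \<Rightarrow> real \<times> real) \<Rightarrow> complex \<Rightarrow> bool" where
  "sheet_winding n p c \<longleftrightarrow> (\<exists>\<theta> M. log_lift (\<lambda>t. circle_coord 1 (p t)) \<theta> \<and>
    log_lift (\<lambda>t. sheet_coord n (p t, \<theta> t)) M \<and> M 1 = c)"

text \<open>Lift a homotopy to the covering, collapse it to the unit circle, and lift once more to \<open>\<complex>\<close>.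
  Since the endpoints of the loops stay at the base point, both lifts have constant endpoints.\<close>

lemma sheet_winding_homotopic:
  assumes n: "n \<noteq> 1" and p: "p \<in> loops_at earring (0, 0)"
    and pq: "homotopic_paths earring p q"
    and c: "sheet_winding n p c" and d: "sheet_winding n q d"
  shows "c = d"
proof -
  obtain h :: "real \<times> real \<Rightarrow> real \<times> real"
    where h: "continuous_on ({0..1} \<times> {0..1}) h"
    and hE: "\<And>z. z \<in> {0..1} \<times> {0..1} \<Longrightarrow> h z \<in> earring"
    and h0: "\<And>t. t \<in> {0..1} \<Longrightarrow> h (0, t) = p t" and h1: "\<And>t. t \<in> {0..1} \<Longrightarrow> h (1, t) = q t"
    and hs: "\<And>s. s \<in> {0..1} \<Longrightarrow> h (s, 0) = p 0" and hf: "\<And>s. s \<in> {0..1} \<Longrightarrow> h (s, 1) = p 1"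
  proof -
    have "\<exists>h :: real \<times> real \<Rightarrow> real \<times> real. continuous_on ({0..1} \<times> {0..1}) h \<and> (\<forall>z\<in>{0..1} \<times> {0..1}. h z \<in> earring) \<and>
        (\<forall>t\<in>{0..1}. h (0, t) = p t) \<and> (\<forall>t\<in>{0..1}. h (1, t) = q t) \<and>
        (\<forall>s\<in>{0..1}. h (s, 0) = p 0 \<and> h (s, 1) = p 1)"
      using pq unfolding homotopic_paths pathstart_def pathfinish_def Pi_iff o_def by (simp only: Ball_def)
    then show ?thesis
      using that by blast
  qed
  have edge: "h (s, 0) = (0, 0) \<and> h (s, 1) = (0, 0)" if "s \<in> {0..1}" for s
    using hs[OF that] hf[OF that] p by (auto simp: loops_at_def pathstart_def pathfinish_def)
  obtain L where L: "continuous_on ({0..1} \<times> {0..1}) L"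
    and eL: "\<And>z. z \<in> {0..1} \<times> {0..1} \<Longrightarrow> exp (L z) = circle_coord 1 (h z)"
    and rowL: "\<And>s. s \<in> {0..1} \<Longrightarrow> log_lift (\<lambda>t. circle_coord 1 (h (s, t))) (\<lambda>t. L (s, t))"
    and "\<And>s. s \<in> {0..1} \<Longrightarrow> L (s, 1) = L (0, 1)"
  proof (rule log_lift_square[of "\<lambda>z. circle_coord 1 (h z)"])
    show "continuous_on ({0..1} \<times> {0..1}) (\<lambda>z. circle_coord 1 (h z))"
      by (rule continuous_on_compose2[OF continuous_on_circle_coord h]) (use hE in blast)
    show "circle_coord 1 (h z) \<noteq> 0" for z
      using norm_circle_coord[of 1 "h z"] by auto
    show "circle_coord 1 (h (s, 0)) = 1 \<and> circle_coord 1 (h (s, 1)) = 1" if "s \<in> {0..1}" for s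
      using edge[OF that] by simp
  qed blast
  obtain M where rowM: "\<And>s. s \<in> {0..1} \<Longrightarrow>
        log_lift (\<lambda>t. sheet_coord n (h (s, t), L (s, t))) (\<lambda>t. M (s, t))"
    and M1: "\<And>s. s \<in> {0..1} \<Longrightarrow> M (s, 1) = M (0, 1)"
  proof (rule log_lift_square[of "\<lambda>z. sheet_coord n (h z, L z)"])
    show "continuous_on ({0..1} \<times> {0..1}) (\<lambda>z. sheet_coord n (h z, L z))"
    proof (rule continuous_on_compose2[OF continuous_on_sheet_coord[OF n]])
      show "continuous_on ({0..1} \<times> {0..1}) (\<lambda>z. (h z, L z))"
        by (intro continuous_on_Pair h L)
      show "(\<lambda>z. (h z, L z)) ` ({0..1} \<times> {0..1}) \<subseteq> cyclic_cover"
        using hE eL by (auto simp: cyclic_cover_def)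
    qed
    show "sheet_coord n (h (s, 0), L (s, 0)) = 1 \<and> sheet_coord n (h (s, 1), L (s, 1)) = 1"
      if "s \<in> {0..1}" for s
      using edge[OF that] by simp
  qed (auto simp: sheet_coord_nonzero)
  have "M (s, 1) = c'" if r: "sheet_winding n r c'" and s: "s \<in> {0..1}"
    and hr: "\<And>t. t \<in> {0..1} \<Longrightarrow> h (s, t) = r t" for r c' s
  proof -
    obtain \<theta> N where \<theta>: "log_lift (\<lambda>t. circle_coord 1 (r t)) \<theta>"
      and N: "log_lift (\<lambda>t. sheet_coord n (r t, \<theta> t)) N" and N1: "N 1 = c'"
      using r unfolding sheet_winding_def by blast
    have "L (s, t) = \<theta> t" if "t \<in> {0..1}" for t
      by (rule log_lift_unique[OF rowL[OF s] \<theta> _ that]) (simp add: hr)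
    then have "M (s, 1) = N 1"
      by (intro log_lift_unique[OF rowM[OF s] N]) (auto simp: hr)
    then show ?thesis
      using N1 by simp
  qed
  from this[OF c _ h0] this[OF d _ h1] M1[of 1] show ?thesis
    by simp
qed

section \<open>Infinite words\<close>

text \<open>The circle \<open>C\<^sub>k\<close> is traversed on the interval from \<open>1 / (k + 1)\<close> to \<open>1 / k\<close>,
  with clock \<open>1 / t\<close>, hence backwards. At \<open>t = 0\<close> the conventions for division by \<open>0\<close> select
  \<open>k = 0\<close>, so the value is \<open>(0, 0)\<close>.\<close>

definition infinite_word :: "nat set \<Rightarrow> real \<Rightarrow> real \<times> real" where
  "infinite_word S t = (let k = nat \<lfloor>1 / t\<rfloor> in
     if k \<in> S then (1 / real k) *\<^sub>R circle_turn (1 / t) else (0, 0))"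

lemma norm_circle_turn: "norm (circle_turn v) \<le> 3"
proof -
  have "norm (circle_turn v) \<le> \<bar>1 - cos (2 * pi * v)\<bar> + \<bar>sin (2 * pi * v)\<bar>"
    using norm_Pair_le[of "1 - cos (2 * pi * v)" "- sin (2 * pi * v)"] by (simp add: circle_turn_def)
  then show ?thesis
    using abs_cos_le_one[of "2 * pi * v"] abs_sin_le_one[of "2 * pi * v"] by linarith
qed

lemma circle_turn_Ints: "v \<in> \<int> \<Longrightarrow> circle_turn v = (0, 0)"
  using cos_int_2pin sin_int_2pin by (auto elim!: Ints_cases simp: circle_turn_def)

lemma isCont_circle_turn: "isCont circle_turn v"
  unfolding circle_turn_def[abs_def] by (intro continuous_intros)

text \<open>The coefficient jumps only at integers, where \<open>circle_turn\<close> vanishes.\<close>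

lemma isCont_step_circle_turn:
  fixes c :: "int \<Rightarrow> real"
  assumes c: "\<And>k. \<bar>c k\<bar> \<le> 1"
  shows "isCont (\<lambda>v. c \<lfloor>v\<rfloor> *\<^sub>R circle_turn v) v"
proof (cases "v \<in> \<int>")
  case True
  have lim: "((\<lambda>v. c \<lfloor>v\<rfloor> *\<^sub>R circle_turn v) \<longlongrightarrow> 0) (at v)"
  proof (rule Lim_null_comparison)
    show "\<forall>\<^sub>F w in at v. norm (c \<lfloor>w\<rfloor> *\<^sub>R circle_turn w) \<le> norm (circle_turn w)"
      using c by (auto intro!: always_eventually mult_left_le_one_le)
    have "(circle_turn \<longlongrightarrow> 0) (at v)"
      using isCont_circle_turn[of v] circle_turn_Ints[OF True] by (simp add: isCont_def zero_prod_def)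
    then show "((\<lambda>w. norm (circle_turn w)) \<longlongrightarrow> 0) (at v)"
      by (rule tendsto_norm_zero)
  qed
  then show ?thesis
    using circle_turn_Ints[OF True] by (simp add: isCont_def zero_prod_def)
next
  case False
  have "\<forall>\<^sub>F w in nhds v. \<lfloor>w\<rfloor> = \<lfloor>v\<rfloor>"
    by (rule eventually_floor_eq[OF filterlim_ident False])
  then have "\<forall>\<^sub>F w in nhds v. c \<lfloor>w\<rfloor> *\<^sub>R circle_turn w = c \<lfloor>v\<rfloor> *\<^sub>R circle_turn w"
    by eventually_elim simp
  moreover have "isCont (\<lambda>w. c \<lfloor>v\<rfloor> *\<^sub>R circle_turn w) v"
    by (intro continuous_intros isCont_circle_turn)
  ultimately show ?thesis
    by (rule isCont_cong[THEN iffD2])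
qed

text \<open>Continuity at \<open>0\<close> uses that \<open>k = \<lfloor>1 / t\<rfloor>\<close> is at least \<open>1 / (2 * t)\<close>, so that the loop is at
  distance at most \<open>3 / k \<le> 6 * t\<close> from the base point.\<close>

lemma path_infinite_word: "path (infinite_word S)"
proof -
  define c where "c k = (if nat k \<in> S then 1 / real (nat k) else 0)" for k
  have word: "infinite_word S t = c \<lfloor>1 / t\<rfloor> *\<^sub>R circle_turn (1 / t)" for t
    by (auto simp: infinite_word_def c_def Let_def zero_prod_def)
  have c1: "\<bar>c k\<bar> \<le> 1" for k
    by (cases "nat k") (auto simp: c_def)
  have "continuous (at t within {0..1}) (infinite_word S)" if t: "t \<in> {0..1}" for t
  proof (cases "t = 0")
    case True
    have bd: "norm (infinite_word S u) \<le> 6 * u" if u: "u \<in> {0..1}" for u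
    proof (cases "u = 0")
      case False
      then have u0: "0 < u" "u \<le> 1" using u by auto
      then have k1: "1 \<le> \<lfloor>1 / u\<rfloor>"
        by (simp add: le_floor_iff)
      define k where "k = real (nat \<lfloor>1 / u\<rfloor>)"
      have k: "k \<ge> 1" "1 / u < k + 1"
        using k1 unfolding k_def by linarith+
      then have "1 / u \<le> 2 * k"
        by linarith
      then have ku: "1 / k \<le> 2 * u"
        using u0 k by (simp add: field_simps)
      have "\<bar>c \<lfloor>1 / u\<rfloor>\<bar> \<le> 1 / k"
        using k by (auto simp: c_def k_def)
      then have "norm (infinite_word S u) \<le> 1 / k * 3"
        unfolding word norm_scaleR by (intro mult_mono norm_circle_turn) (use k in auto)
      then show ?thesis
        using ku by linarith
    qed (simp add: infinite_word_def Let_def circle_turn_def zero_prod_def)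
    have "(infinite_word S \<longlongrightarrow> 0) (at 0 within {0..1})"
    proof (rule Lim_null_comparison)
      show "\<forall>\<^sub>F u in at 0 within {0..1}. norm (infinite_word S u) \<le> 6 * u"
        using bd by (auto simp: eventually_at_filter)
      show "((\<lambda>u. 6 * u) \<longlongrightarrow> 0) (at 0 within {0..1::real})"
        by (auto intro!: tendsto_eq_intros)
    qed
    moreover have "infinite_word S 0 = 0"
      using bd[of 0] by simp
    ultimately show ?thesis
      using True by (simp add: continuous_within)
  next
    case False
    have "isCont (\<lambda>u. 1 / u) t"
      using False by (intro continuous_intros) auto
    then have "isCont (\<lambda>u. c \<lfloor>1 / u\<rfloor> *\<^sub>R circle_turn (1 / u)) t"
      by (rule isCont_o2[where g = "\<lambda>v. c \<lfloor>v\<rfloor> *\<^sub>R circle_turn v"]) (rule isCont_step_circle_turn[OF c1])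
    then show ?thesis
      unfolding word[abs_def] by (rule continuous_at_imp_continuous_at_within)
  qed
  then show ?thesis
    unfolding path_def by (simp add: continuous_on_eq_continuous_within)
qed

lemma infinite_word_in_earring: "infinite_word S t \<in> earring"
proof (cases "nat \<lfloor>1 / t\<rfloor> \<in> S \<and> nat \<lfloor>1 / t\<rfloor> \<ge> 1")
  case True
  then show ?thesis
    using circle_point_in_earring by (auto simp: infinite_word_def Let_def)
next
  case False
  then have "infinite_word S t = (0, 0)"
    by (auto simp: infinite_word_def Let_def zero_prod_def not_le)
  then show ?thesis
    using base_in_earring by simp
qed

lemma infinite_word_loop: "infinite_word S \<in> loops_at earring (0, 0)"
proof -
  have "infinite_word S 1 = (0, 0)"
    using circle_turn_Ints[of 1] by (auto simp: infinite_word_def Let_def)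
  moreover have "infinite_word S 0 = (0, 0)"
    by (simp add: infinite_word_def Let_def circle_turn_def)
  ultimately show ?thesis
    using path_infinite_word infinite_word_in_earring
    by (auto simp: loops_at_def pathstart_def pathfinish_def path_image_def)
qed

lemma circle_turn_loop: "circle_turn \<in> loops_at earring (0, 0)"
proof -
  have "circle_turn t \<in> earring" for t
    using circle_point_in_earring[of 1 t] by simp
  moreover have "path circle_turn"
    unfolding path_def by (simp add: continuous_at_imp_continuous_on isCont_circle_turn)
  ultimately show ?thesis
    by (auto simp: loops_at_def pathstart_def pathfinish_def path_image_def circle_turn_Ints)
qed

lemma circle_coord_infinite_word:
  assumes "n \<ge> 1"
  shows "circle_coord n (infinite_word S t)
    = (if n \<in> S \<and> nat \<lfloor>1 / t\<rfloor> = n then exp (2 * pi * \<i> * (1 / t)) else 1)"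
proof (cases "nat \<lfloor>1 / t\<rfloor> \<in> S \<and> nat \<lfloor>1 / t\<rfloor> \<ge> 1")
  case True
  then show ?thesis
    using circle_coord_circle_point[of "nat \<lfloor>1 / t\<rfloor>" n "1 / t"]
    by (auto simp: infinite_word_def Let_def)
next
  case False
  then have "infinite_word S t = (0, 0)"
    by (auto simp: infinite_word_def Let_def zero_prod_def not_le)
  then show ?thesis
    using False assms by auto
qed

text \<open>The clock \<open>1 / t\<close> stopped outside the interval in which the circle \<open>C\<^sub>n\<close> is traversed is a
  logarithm, up to scaling and an integer shift that makes it start at \<open>0\<close>.\<close>

lemma log_lift_infinite_word:
  assumes n: "n \<ge> 1"
  obtains M where "log_lift (\<lambda>t. circle_coord n (infinite_word S t)) M"
    and "M 1 = (if n \<in> S then - (2 * pi * \<i>) else 0)"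
proof (cases "n \<in> S")
  case True
  define v where "v t = 1 / max (1 / (real n + 1)) (min (1 / real n) t)" for t
  define M where "M t = 2 * pi * \<i> * complex_of_real (v t - (real n + 1))" for t
  have pos: "max (1 / (real n + 1)) (min (1 / real n) t) > 0" for t
    by (simp add: less_max_iff_disj)
  have shift: "exp (M t) = exp (2 * pi * \<i> * v t)" for t
  proof -
    have "M t = 2 * pi * \<i> * v t - 2 * of_nat (Suc n) * pi * \<i>"
      by (simp add: M_def algebra_simps)
    then show ?thesis
      using exp_integer_2pi[of "of_nat (Suc n)"] by (simp only: exp_diff) simp
  qed
  have "exp (M t) = circle_coord n (infinite_word S t)" if t: "t \<in> {0..1}" for t
  proof -
    have int: "exp (2 * pi * \<i> * of_nat m) = 1" for m
      using exp_integer_2pi[of "of_nat m"] by (simp add: mult_ac)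
    consider "t \<le> 1 / (real n + 1)" | "1 / (real n + 1) < t" "t \<le> 1 / real n" | "1 / real n < t"
      by linarith
    then show ?thesis
    proof cases
      case 1
      moreover have "1 / (real n + 1) \<le> 1 / real n"
        using n by (intro divide_left_mono) auto
      ultimately have "max (1 / (real n + 1)) (min (1 / real n) t) = 1 / (real n + 1)"
        by linarith
      then have v: "v t = real (Suc n)"
        by (simp add: v_def)
      have "nat \<lfloor>1 / t\<rfloor> \<noteq> n"
      proof (cases "t = 0")
        case False
        then have "real n + 1 \<le> 1 / t"
          using 1 t by (simp add: field_simps)
        then have "int n + 1 \<le> \<lfloor>1 / t\<rfloor>"
          by (simp add: le_floor_iff)
        then show ?thesis by linarith
      qed (use n in auto)
      then show ?thesis
        using int[of "Suc n"] n v by (simp add: shift circle_coord_infinite_word)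
    next
      case 2
      then have "t > 0"
        by (smt (verit) divide_pos_pos of_nat_0_le_iff)
      with 2 n have "real n \<le> 1 / t" "1 / t < real n + 1"
        by (simp_all add: field_simps)
      then have "\<lfloor>1 / t\<rfloor> = int n"
        by (intro floor_unique) auto
      moreover have "v t = 1 / t"
        using 2 by (simp add: v_def)
      ultimately show ?thesis
        using True n by (simp add: shift circle_coord_infinite_word)
    next
      case 3
      have "1 / (real n + 1) \<le> 1 / real n"
        using n by (intro divide_left_mono) auto
      then have v: "v t = real n"
        using 3 by (simp add: v_def max_def min_def)
      have "t > 0"
        using 3 by (smt (verit) divide_nonneg_nonneg of_nat_0_le_iff)
      then have "1 / t < real n"
        using 3 n by (simp add: field_simps)
      then have "\<lfloor>1 / t\<rfloor> < int n"
        by (simp add: floor_less_iff)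
      then have "nat \<lfloor>1 / t\<rfloor> \<noteq> n"
        using n by linarith
      then show ?thesis
        using int[of n] n v by (simp add: shift circle_coord_infinite_word)
    qed
  qed
  moreover have "continuous_on {0..1} M"
    unfolding M_def v_def using pos by (intro continuous_intros) (auto simp: less_imp_neq[symmetric])
  moreover have "v 0 = real n + 1" and v1: "v 1 = real n"
  proof -
    have "1 / (real n + 1) \<le> 1 / real n" "1 / real n \<le> 1"
      using n by (auto intro!: divide_left_mono)
    then show "v 0 = real n + 1" "v 1 = real n"
      by (auto simp: v_def max_def min_def)
  qed
  ultimately have "log_lift (\<lambda>t. circle_coord n (infinite_word S t)) M"
    by (simp add: log_lift_def M_def)
  then show ?thesis
    by (rule that) (use True v1 in \<open>simp add: M_def\<close>)
next
  case False
  have "log_lift (\<lambda>t. circle_coord n (infinite_word S t)) (\<lambda>t. 0)"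
    using False n by (simp add: log_lift_def circle_coord_infinite_word)
  then show ?thesis
    by (rule that) (use False in simp)
qed

section \<open>Separating the cosets\<close>

text \<open>\<open>(2, 0)\<close> is the only point of the earring that the collapse onto \<open>C\<^sub>1\<close> maps to \<open>-1\<close>, so the
  principal logarithm is continuous along a loop that avoids it.\<close>

lemma log_lift_punctured:
  assumes \<eta>: "\<eta> \<in> loops_at (earring - {(2, 0)}) (0, 0)"
  shows "log_lift (\<lambda>t. circle_coord 1 (\<eta> t)) (\<lambda>t. Ln (circle_coord 1 (\<eta> t)))"
proof -
  have im: "\<eta> t \<in> earring - {(2, 0)}" if "t \<in> {0..1}" for t
    using \<eta> that unfolding loops_at_def path_image_def by blast
  have slit: "circle_coord 1 z \<notin> \<real>\<^sub>\<le>\<^sub>0" if "z \<noteq> (2, 0)" for z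
  proof
    assume R: "circle_coord 1 z \<in> \<real>\<^sub>\<le>\<^sub>0"
    then have "circle_coord 1 z = -1"
      using norm_circle_coord[of 1 z]
      by (auto simp: complex_nonpos_Reals_iff complex_eq_iff cmod_def)
    then have "1 - fst z = -1" "snd z = 0"
      by (auto simp: circle_coord_def complex_eq_iff split: if_splits)
    then show False
      using that by (simp add: prod_eq_iff)
  qed
  have "continuous_on {0..1} (\<lambda>t. circle_coord 1 (\<eta> t))"
    by (rule continuous_on_compose2[OF continuous_on_circle_coord])
      (use \<eta> im in \<open>auto simp: loops_at_def path_def\<close>)
  then have "continuous_on {0..1} (\<lambda>t. Ln (circle_coord 1 (\<eta> t)))"
    by (rule continuous_on_Ln') (use im slit in blast)
  moreover have "exp (Ln (circle_coord 1 z)) = circle_coord 1 z" for z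
    using norm_circle_coord[of 1 z] by (intro exp_Ln) auto
  moreover have "\<eta> 0 = (0, 0)"
    using \<eta> by (simp add: loops_at_def pathstart_def)
  ultimately show ?thesis
    by (simp add: log_lift_def)
qed

text \<open>The lift to the covering stays at height \<open>0\<close> along the word, moves up by one sheet along
  \<open>C\<^sub>1\<close>, and then stays strictly between the heights \<open>\<pi>\<close> and \<open>3\<pi>\<close>. Only the first part
  contributes turns in the copy at \<open>0\<close>.\<close>

lemma sheet_winding_word:
  assumes n: "n \<ge> 2" and S: "S \<subseteq> {2..}"
    and \<eta>: "\<eta> \<in> loops_at (earring - {(2, 0)}) (0, 0)"
  shows "sheet_winding n ((infinite_word S +++ circle_turn) +++ \<eta>)
    (if n \<in> S then - (2 * pi * \<i>) else 0)"
proof -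
  define w where "w = infinite_word S"
  define \<alpha> where "\<alpha> t = 2 * pi * \<i> * complex_of_real t" for t
  define \<beta> where "\<beta> t = Ln (circle_coord 1 (\<eta> t))" for t
  define \<theta> where "\<theta> = ((\<lambda>t. 0) +++ \<alpha>) +++ (\<lambda>t. 2 * pi * \<i> + \<beta> t)"
  have turn: "circle_coord m (circle_turn t) = (if m = 1 then exp (\<alpha> t) else 1)" for m t
    using circle_coord_circle_point[of 1 m t] by (simp add: \<alpha>_def)
  have w1: "w 1 = (0, 0)" and a1: "circle_turn 1 = (0, 0)"
    using infinite_word_loop circle_turn_loop by (auto simp: w_def loops_at_def pathfinish_def)
  have join: "(\<lambda>t. f ((p +++ q) t)) = (\<lambda>t. f (p t)) +++ (\<lambda>t. f (q t))"
    for f :: "real \<times> real \<Rightarrow> complex" and p q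
    by (auto simp: joinpaths_def)
  have join2: "(\<lambda>t. f ((p +++ q) t, (g +++ h) t)) = (\<lambda>t. f (p t, g t)) +++ (\<lambda>t. f (q t, h t))"
    for f :: "(real \<times> real) \<times> complex \<Rightarrow> complex" and p q g h
    by (auto simp: joinpaths_def)
  have "log_lift (\<lambda>t. circle_coord 1 (w t)) (\<lambda>t. 0)"
    using S by (auto simp: log_lift_def w_def circle_coord_infinite_word)
  moreover have "log_lift (\<lambda>t. circle_coord 1 (circle_turn t)) \<alpha>"
    unfolding log_lift_def turn by (auto simp: \<alpha>_def intro!: continuous_intros)
  ultimately have "log_lift (\<lambda>t. circle_coord 1 ((w +++ circle_turn) t)) ((\<lambda>t. 0) +++ \<alpha>)"
    unfolding join using log_lift_join[of _ "\<lambda>t. 0" _ \<alpha>] w1 by simp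
  moreover have "log_lift (\<lambda>t. circle_coord 1 (\<eta> t)) \<beta>"
    unfolding \<beta>_def by (rule log_lift_punctured[OF \<eta>])
  moreover have "((\<lambda>t. 0) +++ \<alpha>) 1 = 2 * pi * \<i>" "(w +++ circle_turn) 1 = (0, 0)"
    by (simp_all add: joinpaths_def \<alpha>_def a1)
  ultimately have \<theta>: "log_lift (\<lambda>t. circle_coord 1 (((w +++ circle_turn) +++ \<eta>) t)) \<theta>"
    unfolding join[of _ "w +++ circle_turn"] \<theta>_def
    using log_lift_join[of "\<lambda>t. circle_coord 1 ((w +++ circle_turn) t)" "(\<lambda>t. 0) +++ \<alpha>"] by simp
  obtain M where M: "log_lift (\<lambda>t. circle_coord n (w t)) M"
    and M1: "M 1 = (if n \<in> S then - (2 * pi * \<i>) else 0)"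
    using log_lift_infinite_word[of n S] n unfolding w_def by auto
  define N where "N = (M +++ (\<lambda>t. M 1 + 0)) +++ (\<lambda>t. (M +++ (\<lambda>t. M 1 + 0)) 1 + 0)"
  have zero: "log_lift (\<lambda>t. 1) (\<lambda>t. 0)"
    by (simp add: log_lift_def)
  have s1: "(\<lambda>t. sheet_coord n (w t, 0)) = (\<lambda>t. circle_coord n (w t))"
    by (simp add: sheet_coord_def)
  have s2: "(\<lambda>t. sheet_coord n (circle_turn t, \<alpha> t)) = (\<lambda>t. 1)"
    using turn n by (auto simp: sheet_coord_def)
  have s3: "(\<lambda>t. sheet_coord n (\<eta> t, 2 * pi * \<i> + \<beta> t)) = (\<lambda>t. 1)"
  proof
    fix t
    have "circle_coord 1 (\<eta> t) \<noteq> 0"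
      using norm_circle_coord[of 1 "\<eta> t"] by auto
    then have "- pi < Im (\<beta> t)"
      unfolding \<beta>_def by (rule mpi_less_Im_Ln)
    then show "sheet_coord n (\<eta> t, 2 * pi * \<i> + \<beta> t) = 1"
      by (simp add: sheet_coord_def)
  qed
  have "log_lift (\<lambda>t. sheet_coord n (((w +++ circle_turn) +++ \<eta>) t, \<theta> t)) N"
    unfolding \<theta>_def join2 s1 s2 s3 N_def
    by (intro log_lift_join M zero) (simp_all add: w1 joinpaths_def)
  moreover have "N 1 = (if n \<in> S then - (2 * pi * \<i>) else 0)"
    using M1 by (simp add: N_def joinpaths_def)
  ultimately show ?thesis
    using \<theta> unfolding sheet_winding_def w_def by blast
qed

lemma whisker_nbhds_disjoint:
  assumes S: "S \<subseteq> {2..}" and T: "T \<subseteq> {2..}"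
    and cS: "c \<in> whisker_nbhd earring (0, 0) (infinite_word S +++ circle_turn) (earring - {(2, 0)})"
    and cT: "c \<in> whisker_nbhd earring (0, 0) (infinite_word T +++ circle_turn) (earring - {(2, 0)})"
  shows "S = T"
proof -
  let ?U = "earring - {(2, 0)}"
  obtain \<eta> where \<eta>: "\<eta> \<in> loops_at ?U (0, 0)"
    and c\<eta>: "c = path_class earring ((infinite_word S +++ circle_turn) +++ \<eta>)"
    using cS unfolding whisker_nbhd_def by blast
  obtain \<delta> where \<delta>: "\<delta> \<in> loops_at ?U (0, 0)"
    and c\<delta>: "c = path_class earring ((infinite_word T +++ circle_turn) +++ \<delta>)"
    using cT unfolding whisker_nbhd_def by blast
  have loop: "(infinite_word S +++ circle_turn) +++ \<eta> \<in> loops_at earring (0, 0)"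
    using loops_at_mono[of ?U earring] \<eta>
    by (intro loops_at_join infinite_word_loop circle_turn_loop) blast
  have hom: "homotopic_paths earring ((infinite_word S +++ circle_turn) +++ \<eta>)
      ((infinite_word T +++ circle_turn) +++ \<delta>)"
    using c\<eta> c\<delta> path_class_eq_iff[OF loop] by blast
  have "n \<in> S \<longleftrightarrow> n \<in> T" if "n \<ge> 2" for n
  proof -
    have "(if n \<in> S then - (2 * pi * \<i>) else 0) = (if n \<in> T then - (2 * pi * \<i>) else (0::complex))"
      by (rule sheet_winding_homotopic[OF _ loop hom sheet_winding_word[OF that S \<eta>]
            sheet_winding_word[OF that T \<delta>]]) (use that in simp)
    then show ?thesis
      by (simp split: if_splits)
  qed
  then show ?thesis
    using S T by fastforce
qed

theorem theorem5p9:
  shows "\<not> separable_space (whisker_topology earring (0, 0))"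
proof
  let ?X = "whisker_topology earring (0, 0)" and ?U = "earring - {(2, 0)}"
  let ?B = "\<lambda>S. whisker_nbhd earring (0, 0) (infinite_word S +++ circle_turn) ?U"
  assume "separable_space ?X"
  then obtain D where D: "countable D" "?X closure_of D = topspace ?X"
    unfolding separable_space_def by blast
  have meet: "\<exists>c. c \<in> D \<inter> ?B S" for S
  proof -
    have \<zeta>: "infinite_word S +++ circle_turn \<in> loops_at earring (0, 0)"
      by (intro loops_at_join infinite_word_loop circle_turn_loop)
    have U: "openin (top_of_set earring) ?U" "(0, 0) \<in> ?U"
      using base_in_earring by (auto simp: openin_delete)
    have "whisker_basic earring (0, 0) (?B S)"
      unfolding whisker_basic_def using \<zeta> U by blast
    then have op: "openin ?X (?B S)"
      unfolding openin_whisker_topology arbitrary_union_of_alt by blast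
    moreover have "path_class earring (infinite_word S +++ circle_turn) \<in> ?B S"
      by (rule whisker_nbhd_self[OF \<zeta> U(2)])
    ultimately show ?thesis
      using D(2) openin_subset[OF op] by (force simp: in_closure_of set_eq_iff)
  qed
  then obtain d where d: "\<And>S. d S \<in> D \<inter> ?B S"
    by metis
  have "inj_on d (Pow {2..})"
  proof (rule inj_onI)
    fix S T assume "S \<in> Pow {2..}" "T \<in> Pow {2..}" "d S = d T"
    then show "S = T"
      using d[of S] d[of T] by (intro whisker_nbhds_disjoint[of S T "d S"]) auto
  qed
  moreover have "countable (d ` Pow {2..})"
    by (rule countable_subset[OF _ D(1)]) (use d in auto)
  ultimately have "countable (Pow {2::nat..})"
    by (rule countable_image_inj_on[rotated])
  then obtain f :: "nat \<Rightarrow> nat set" where f: "range f = Pow {2..}"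
    using uncountable_def[of "Pow {2::nat..}"] by blast
  \<comment> \<open>Cantor's diagonal argument, with the indices shifted by \<open>2\<close>.\<close>
  have "{n. n \<ge> 2 \<and> n \<notin> f (n - 2)} \<in> range f"
    unfolding f by auto
  then obtain m where "f m = {n. n \<ge> 2 \<and> n \<notin> f (n - 2)}"
    by (metis (no_types, lifting) imageE)
  then have "m + 2 \<in> f m \<longleftrightarrow> m + 2 \<notin> f m"
    by (metis (no_types, lifting) add_diff_cancel_right' le_add2 mem_Collect_eq)
  then show False
    by blast
qed

end
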